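(* Let $V$ be the vector space spanned by the couples $(t,s)$ where $t$ is a rooted tree and $s=P^{c_0}(t)$ is the pruning of $t$ by an admissible cut $c_0$ of $t$. For $(t_1,s_1),(t_2,s_2)\in V$ set $$(t_1,s_1)\leadsto(t_2,s_2):=\sum_{v\in\mathcal V(t_2-s_2)}\big(t_1\rightarrow_v t_2,\; s_1s_2\big),$$ extended bilinearly. Then $(V,\leadsto)$ is a (left) pre-Lie algebra.
   Context: Rooted trees are finite, non-planar, non-empty. A forest is a finite (possibly empty) disjoint union of rooted trees; $\mathbf 1$ denotes the empty forest. An admissible cut $c$ of a tree $t$ is a collection of edges of $t$ such that any path from the root to a leaf contains at most one edge of the collection. The pruning $P^c(t)$ is the subforest of $t$ above the cut, and the trunk $R^c(t)$ is the subtree below the cut. The empty cut ($P^c(t)=\mathbf 1$, $R^c(t)=t$) and the total cut ($P^c(t)=t$, $R^c(t)=\mathbf 1$) are both counted as admissible. In a couple $(t,s)\in V$, $s$ is regarded as a subforest of $t$. $\mathcal V(t_2-s_2)$ is the set of vertices of $t_2$ that are not vertices of $s_2$. $t_1\rightarrow_v t_2$ is the tree obtained by grafting the root of $t_1$ on the vertex $v$ of $t_2$ (adding an edge from $v$ to the root of $t_1$). $s_1s_2$ is the disjoint union of $s_1$ and $s_2$, viewed as a subforest of $t_1\rightarrow_v t_2$. A left pre-Lie algebra is a vector space $A$ with a bilinear product $\triangleright$ such that $(x\triangleright y)\triangleright z-x\triangleright(y\triangleright z)=(y\triangleright x)\triangleright z-y\triangleright(x\triangleright z)$ for all $x,y,z\in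 A$. *)

theory Defs
  imports Complex_Main "HOL-Library.Poly_Mapping"
begin

text \<open>
  Edges are oriented away from the root, so forests grow upwards from their roots.
  Vertices are natural numbers; every finite tree has such a copy, and couples are
  considered up to isomorphism further below.
\<close>

record forest =
  verts :: "nat set"
  edges :: "(nat \<times> nat) set"

record tree = forest +
  root_vertex :: nat

definition rooted_tree :: "tree \<Rightarrow> bool" where
  "rooted_tree t \<longleftrightarrow>
     finite (verts t) \<and> root_vertex t \<in> verts t \<and> edges t \<subseteq> verts t \<times> verts t \<and>
     (\<forall>v\<in>verts t. (root_vertex t, v) \<in> (edges t)\<^sup>*) \<and>
     (\<forall>u. (u, root_vertex t) \<notin> edges t) \<and>
     (\<forall>u u' v. (u, v) \<in> edges t \<longrightarrow> (u', v) \<in> edges t \<longrightarrow> u = u')"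

definition leaf :: "tree \<Rightarrow> nat \<Rightarrow> bool" where
  "leaf t v \<longleftrightarrow> v \<in> verts t \<and> (\<forall>w. (v, w) \<notin> edges t)"

definition root_leaf_path :: "tree \<Rightarrow> nat list \<Rightarrow> bool" where
  "root_leaf_path t p \<longleftrightarrow>
     p \<noteq> [] \<and> hd p = root_vertex t \<and> leaf t (last p) \<and> successively (\<lambda>u v. (u, v) \<in> edges t) p"

definition path_edges :: "nat list \<Rightarrow> (nat \<times> nat) set" where
  "path_edges p = set (zip p (tl p))"

text \<open>
  The total cut is not a set of edges: it is the additional cut whose pruning is the
  whole tree. The empty cut is \<open>Edge_Cut {}\<close>.
\<close>

datatype cut = Edge_Cut "(nat \<times> nat) set" | Total_Cut

fun admissible :: "tree \<Rightarrow> cut \<Rightarrow> bool" where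
  "admissible t (Edge_Cut C) \<longleftrightarrow>
     C \<subseteq> edges t \<and> (\<forall>p. root_leaf_path t p \<longrightarrow> card (path_edges p \<inter> C) \<le> 1)"
| "admissible t Total_Cut \<longleftrightarrow> True"

definition induced :: "tree \<Rightarrow> nat set \<Rightarrow> forest" where
  "induced t W = \<lparr>verts = W, edges = edges t \<inter> (W \<times> W)\<rparr>"

fun pruning :: "tree \<Rightarrow> cut \<Rightarrow> forest" where
  "pruning t (Edge_Cut C) = induced t {v. \<exists>(a, b)\<in>C. (b, v) \<in> (edges t)\<^sup>*}"
| "pruning t Total_Cut = \<lparr>verts = verts t, edges = edges t\<rparr>"

definition is_couple :: "tree \<times> forest \<Rightarrow> bool" where
  "is_couple = (\<lambda>(t, s). rooted_tree t \<and> (\<exists>c. admissible t c \<and> s = pruning t c))"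

definition relabel_forest :: "(nat \<Rightarrow> nat) \<Rightarrow> forest \<Rightarrow> forest" where
  "relabel_forest f s = \<lparr>verts = f ` verts s, edges = map_prod f f ` edges s\<rparr>"

definition relabel_tree :: "(nat \<Rightarrow> nat) \<Rightarrow> tree \<Rightarrow> tree" where
  "relabel_tree f t =
     \<lparr>verts = f ` verts t, edges = map_prod f f ` edges t, root_vertex = f (root_vertex t)\<rparr>"

text \<open>
  An isomorphism of couples is an isomorphism of the trees that carries the one
  distinguished subforest onto the other. So the position of \<open>s\<close> inside \<open>t\<close> is part of
  the data, not only the isomorphism types of \<open>t\<close> and \<open>s\<close>.
\<close>

definition couple_iso :: "tree \<times> forest \<Rightarrow> tree \<times> forest \<Rightarrow> bool" where
  "couple_iso = (\<lambda>(t, s) (t', s').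
     is_couple (t, s) \<and> is_couple (t', s') \<and>
     (\<exists>f. inj_on f (verts t) \<and> t' = relabel_tree f t \<and> s' = relabel_forest f s))"

definition up_closed :: "tree \<Rightarrow> nat set \<Rightarrow> bool" where
  "up_closed t W \<longleftrightarrow> W \<subseteq> verts t \<and> edges t `` W \<subseteq> W"

lemma up_closed_rtrancl:
  assumes "up_closed t W" "(u, v) \<in> (edges t)\<^sup>*" "u \<in> W"
  shows "v \<in> W"
  using assms(2,3,1) by (induction rule: rtrancl_induct) (auto simp: up_closed_def)

lemma path_in_up_closed:
  assumes "up_closed t W"
  shows "successively (\<lambda>u v. (u, v) \<in> edges t) p \<Longrightarrow> p \<noteq> [] \<Longrightarrow> hd p \<in> W \<Longrightarrow> set p \<subseteq> W"
proof (induction p rule: induct_list012)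
  case (3 x y zs)
  then have "y \<in> W" using assms by (auto simp: up_closed_def)
  then show ?case using 3 by auto
qed auto

lemma path_crosses_once:
  assumes "up_closed t W"
  shows "successively (\<lambda>u v. (u, v) \<in> edges t) p \<Longrightarrow>
    \<exists>e. path_edges p \<inter> {(a, b) \<in> edges t. a \<notin> W \<and> b \<in> W} \<subseteq> {e}"
proof (induction p rule: induct_list012)
  case (3 x y zs)
  have pe: "path_edges (x # y # zs) = insert (x, y) (path_edges (y # zs))"
    by (simp add: path_edges_def)
  show ?case
  proof (cases "y \<in> W")
    case True
    then have "set (y # zs) \<subseteq> W"
      using path_in_up_closed[OF assms, of "y # zs"] 3 by auto
    moreover have "a \<in> set (y # zs)" if "(a, b) \<in> path_edges (y # zs)" for a b
      using that unfolding path_edges_def by (rule set_zip_leftD)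
    ultimately have "a \<in> W" if "(a, b) \<in> path_edges (y # zs)" for a b
      using that by blast
    then show ?thesis unfolding pe by (intro exI[of _ "(x, y)"]) auto
  next
    case False
    then show ?thesis using 3 unfolding pe by auto
  qed
qed (auto simp: path_edges_def)

text \<open>Prunings are exactly the subforests spanned by the upward closed vertex sets.\<close>

lemma is_couple_iff:
  "is_couple (t, s) \<longleftrightarrow> rooted_tree t \<and> (\<exists>W. up_closed t W \<and> s = induced t W)"
proof (cases "rooted_tree t")
  case True
  note rt = True[unfolded rooted_tree_def]
  have "\<exists>W. up_closed t W \<and> pruning t c = induced t W" if adm: "admissible t c" for c
  proof (cases c)
    case (Edge_Cut C)
    let ?W = "{v. \<exists>(a, b)\<in>C. (b, v) \<in> (edges t)\<^sup>*}"
    have "v \<in> verts t" if "(b, v) \<in> (edges t)\<^sup>*" "b \<in> verts t" for b v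
      using that rt by (induction rule: rtrancl_induct) auto
    moreover have "C \<subseteq> verts t \<times> verts t"
      using adm Edge_Cut rt by auto
    ultimately have "?W \<subseteq> verts t" by auto
    moreover have "edges t `` ?W \<subseteq> ?W"
      using rtrancl_into_rtrancl[of _ _ "edges t"] by blast
    ultimately show ?thesis using Edge_Cut by (auto simp: up_closed_def intro!: exI[of _ ?W])
  next
    case Total_Cut
    then show ?thesis using rt
      by (auto simp: up_closed_def induced_def intro!: exI[of _ "verts t"])
  qed
  moreover have "\<exists>c. admissible t c \<and> induced t W = pruning t c" if W: "up_closed t W" for W
  proof (cases "root_vertex t \<in> W")
    case True
    then have "W = verts t"
      using rt W up_closed_rtrancl[OF W] by (auto simp: up_closed_def)
    then show ?thesis using rt by (intro exI[of _ Total_Cut]) (auto simp: induced_def)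
  next
    case False
    let ?C = "{(a, b) \<in> edges t. a \<notin> W \<and> b \<in> W}"
    have "card (path_edges p \<inter> ?C) \<le> 1" if p: "root_leaf_path t p" for p
    proof -
      obtain e where e: "path_edges p \<inter> ?C \<subseteq> {e}"
        using path_crosses_once[OF W] p unfolding root_leaf_path_def by blast
      from card_mono[OF _ e] show ?thesis by simp
    qed
    then have adm: "admissible t (Edge_Cut ?C)" by auto
    have "v \<in> W \<longrightarrow> (\<exists>(a, b)\<in>?C. (b, v) \<in> (edges t)\<^sup>*)" if "(root_vertex t, v) \<in> (edges t)\<^sup>*" for v
      using that
    proof (induction rule: rtrancl_induct)
      case base
      then show ?case using False by simp
    next
      case (step u v)
      show ?case
      proof (cases "u \<in> W")
        case True
        then show ?thesis using step by (fastforce intro: rtrancl_into_rtrancl)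
      next
        case False
        then show ?thesis using step by blast
      qed
    qed
    moreover have "(root_vertex t, v) \<in> (edges t)\<^sup>*" if "v \<in> W" for v
      using that rt W by (auto simp: up_closed_def)
    ultimately have "W \<subseteq> {v. \<exists>(a, b)\<in>?C. (b, v) \<in> (edges t)\<^sup>*}" by blast
    moreover have "{v. \<exists>(a, b)\<in>?C. (b, v) \<in> (edges t)\<^sup>*} \<subseteq> W"
      using up_closed_rtrancl[OF W] by auto
    ultimately have "{v. \<exists>(a, b)\<in>?C. (b, v) \<in> (edges t)\<^sup>*} = W"
      by (rule subset_antisym[rotated])
    then have "induced t W = pruning t (Edge_Cut ?C)" by simp
    with adm show ?thesis by blast
  qed
  ultimately show ?thesis using True by (auto simp: is_couple_def)
qed (auto simp: is_couple_def)

lemma rooted_tree_relabel: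
  assumes t: "rooted_tree t" and f: "inj_on f (verts t)"
  shows "rooted_tree (relabel_tree f t)"
proof -
  note rt = t[unfolded rooted_tree_def]
  have reach: "(f u, f v) \<in> (map_prod f f ` edges t)\<^sup>*" if "(u, v) \<in> (edges t)\<^sup>*" for u v
    using that by (induction rule: rtrancl_induct) (auto intro: rtrancl_into_rtrancl)
  have "\<forall>u. (u, f (root_vertex t)) \<notin> map_prod f f ` edges t"
  proof (intro allI notI)
    fix u assume "(u, f (root_vertex t)) \<in> map_prod f f ` edges t"
    then obtain a b where "(a, b) \<in> edges t" "f b = f (root_vertex t)" by auto
    moreover from this have "b = root_vertex t" using f rt by (auto dest: inj_onD)
    ultimately show False using rt by auto
  qed
  moreover have "u = u'"
    if uv: "(u, v) \<in> map_prod f f ` edges t" "(u', v) \<in> map_prod f f ` edges t" for u u' v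
  proof -
    obtain a b where ab: "(a, b) \<in> edges t" "u = f a" "v = f b" using uv by auto
    obtain a' b' where ab': "(a', b') \<in> edges t" "u' = f a'" "v = f b'" using uv by auto
    have "f b = f b'" using ab ab' by simp
    then have "b = b'" using f ab ab' rt by (auto dest: inj_onD)
    then have "a = a'" using ab ab' rt by blast
    then show ?thesis using ab ab' by simp
  qed
  ultimately show ?thesis using rt reach
    unfolding rooted_tree_def relabel_tree_def by (auto simp del: map_prod_imageI)
qed

lemma is_couple_relabel:
  assumes c: "is_couple (t, s)" and f: "inj_on f (verts t)"
  shows "is_couple (relabel_tree f t, relabel_forest f s)"
proof -
  obtain W where W: "up_closed t W" "s = induced t W" and t: "rooted_tree t"
    using c by (auto simp: is_couple_iff)
  have E: "edges t \<subseteq> verts t \<times> verts t" using t by (simp add: rooted_tree_def)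
  have mem: "f x \<in> f ` W \<longleftrightarrow> x \<in> W" if "x \<in> verts t" for x
    using that f W by (auto simp: up_closed_def dest: inj_onD)
  have "up_closed (relabel_tree f t) (f ` W)"
  proof -
    have "y \<in> f ` W" if x: "x \<in> W" and xy: "(f x, y) \<in> map_prod f f ` edges t" for x y
    proof -
      obtain a b where ab: "(a, b) \<in> edges t" "f x = f a" "y = f b" using xy by auto
      then have "a \<in> verts t" "f a \<in> f ` W" using x E imageI[OF x, of f] by auto
      then have "a \<in> W" using mem by simp
      then show ?thesis using ab W by (auto simp: up_closed_def)
    qed
    then have "(map_prod f f ` edges t) `` (f ` W) \<subseteq> f ` W"
      by (intro subsetI, elim ImageE imageE[of _ f]) simp
    moreover have "f ` W \<subseteq> f ` verts t" using W by (auto simp: up_closed_def)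
    ultimately show ?thesis by (simp add: up_closed_def relabel_tree_def)
  qed
  moreover have "map_prod f f ` edges t \<inter> (f ` W \<times> f ` W) = map_prod f f ` (edges t \<inter> (W \<times> W))"
  proof (intro equalityI subsetI)
    fix e assume e: "e \<in> map_prod f f ` edges t \<inter> (f ` W \<times> f ` W)"
    then obtain a b where ab: "(a, b) \<in> edges t" "e = (f a, f b)" by auto
    then have "a \<in> verts t" "b \<in> verts t" "f a \<in> f ` W" "f b \<in> f ` W" using e E by blast+
    then have "(a, b) \<in> edges t \<inter> (W \<times> W)" using ab mem by simp
    then show "e \<in> map_prod f f ` (edges t \<inter> (W \<times> W))"
      unfolding ab(2) by (metis map_prod_imageI)
  qed auto
  then have "relabel_forest f s = induced (relabel_tree f t) (f ` W)"
    using W by (simp add: relabel_forest_def relabel_tree_def induced_def)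
  ultimately show ?thesis using rooted_tree_relabel[OF t f] by (auto simp: is_couple_iff)
qed

lemma is_couple_subforest:
  assumes "is_couple (t, s)"
  shows "verts s \<subseteq> verts t" "edges s \<subseteq> edges t" "edges t \<subseteq> verts t \<times> verts t"
    "edges s \<subseteq> verts s \<times> verts s" "root_vertex t \<in> verts t"
  using assms by (auto simp: is_couple_iff up_closed_def induced_def rooted_tree_def)

lemma couple_iso_refl: "is_couple c \<Longrightarrow> couple_iso c c"
  by (cases c) (auto simp: couple_iso_def relabel_tree_def relabel_forest_def map_prod.identity
      intro!: exI[of _ "\<lambda>x. x"])

lemma couple_iso_sym: "couple_iso c c' \<Longrightarrow> couple_iso c' c"
proof -
  assume iso: "couple_iso c c'"
  obtain t s t' s' where c: "c = (t, s)" "c' = (t', s')" by (cases c; cases c') auto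
  from iso c obtain f where f: "is_couple (t, s)" "is_couple (t', s')" "inj_on f (verts t)"
    "t' = relabel_tree f t" "s' = relabel_forest f s" by (auto simp: couple_iso_def)
  note sub = is_couple_subforest[OF f(1)]
  let ?g = "inv_into (verts t) f"
  have inv: "?g (f x) = x" if "x \<in> verts t" for x using f(3) that by simp
  have V: "?g ` f ` A = A" if "A \<subseteq> verts t" for A
    using that inv by (force simp: image_image)
  have E: "map_prod ?g ?g ` map_prod f f ` A = A" if "A \<subseteq> verts t \<times> verts t" for A
  proof -
    have "map_prod ?g ?g (map_prod f f e) = e" if "e \<in> A" for e
      using that \<open>A \<subseteq> _\<close> inv by (cases e) auto
    then show ?thesis by (force simp: image_image)
  qed
  have "t = relabel_tree ?g t'" using f sub inv V E by (simp add: relabel_tree_def)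
  moreover have "edges s \<subseteq> verts t \<times> verts t" using sub by blast
  then have "s = relabel_forest ?g s'" using f sub V E by (simp add: relabel_forest_def)
  moreover have "inj_on ?g (verts t')"
    using f by (simp add: relabel_tree_def inj_on_inv_into)
  ultimately show ?thesis using f c by (auto simp: couple_iso_def)
qed

lemma couple_iso_trans: "couple_iso c c' \<Longrightarrow> couple_iso c' c'' \<Longrightarrow> couple_iso c c''"
proof -
  assume iso: "couple_iso c c'" "couple_iso c' c''"
  obtain t s t' s' t'' s'' where c: "c = (t, s)" "c' = (t', s')" "c'' = (t'', s'')"
    by (cases c; cases c'; cases c'') auto
  from iso c obtain f g where f: "is_couple (t, s)" "inj_on f (verts t)"
    "t' = relabel_tree f t" "s' = relabel_forest f s"
    and g: "is_couple (t'', s'')" "inj_on g (verts t')"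
    "t'' = relabel_tree g t'" "s'' = relabel_forest g s'" by (auto simp: couple_iso_def)
  have "t'' = relabel_tree (g \<circ> f) t" "s'' = relabel_forest (g \<circ> f) s"
    using f g by (auto simp: relabel_tree_def relabel_forest_def image_image prod.map_comp)
  moreover have "inj_on (g \<circ> f) (verts t)"
    using f g by (auto simp: relabel_tree_def intro: comp_inj_on)
  ultimately show ?thesis using f g c by (auto simp: couple_iso_def)
qed

lemma couple_iso_part_equivp: "part_equivp couple_iso"
proof (rule part_equivpI)
  let ?t = "\<lparr>verts = {0}, edges = {}, root_vertex = 0\<rparr>"
  have "is_couple (?t, \<lparr>verts = {0}, edges = {}\<rparr>)"
    by (auto simp: is_couple_def rooted_tree_def intro!: exI[of _ Total_Cut])
  then show "\<exists>c. couple_iso c c" using couple_iso_refl by blast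
qed (auto intro: sympI transpI couple_iso_sym couple_iso_trans)

text \<open>
  The relation is partial, so the elements of the quotient are exactly the isomorphism
  classes of the pairs that satisfy \<open>is_couple\<close>.
\<close>

quotient_type couple = "tree \<times> forest" / partial: couple_iso
  by (rule couple_iso_part_equivp)

text \<open>Both operations are meant for arguments with disjoint vertex sets.\<close>

definition graft :: "tree \<Rightarrow> nat \<Rightarrow> tree \<Rightarrow> tree" where
  "graft t1 v t2 =
     \<lparr>verts = verts t1 \<union> verts t2,
      edges = edges t1 \<union> edges t2 \<union> {(v, root_vertex t1)},
      root_vertex = root_vertex t2\<rparr>"

definition forest_union :: "forest \<Rightarrow> forest \<Rightarrow> forest" where
  "forest_union s1 s2 = \<lparr>verts = verts s1 \<union> verts s2, edges = edges s1 \<union> edges s2\<rparr>"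

definition left_copy :: "nat \<Rightarrow> nat" where "left_copy n = 2 * n"

definition right_copy :: "nat \<Rightarrow> nat" where "right_copy n = 2 * n + 1"

definition graft_couple :: "tree \<times> forest \<Rightarrow> nat \<Rightarrow> tree \<times> forest \<Rightarrow> tree \<times> forest" where
  "graft_couple = (\<lambda>(t1, s1) v (t2, s2).
     (graft (relabel_tree left_copy t1) (right_copy v) (relabel_tree right_copy t2),
      forest_union (relabel_forest left_copy s1) (relabel_forest right_copy s2)))"

lemma inj_left_copy: "inj left_copy"
  by (auto simp: left_copy_def inj_def)

lemma inj_right_copy: "inj right_copy"
  by (auto simp: right_copy_def inj_def)

lemma left_copy_neq_right_copy: "left_copy m \<noteq> right_copy n"
  unfolding left_copy_def right_copy_def by presburger

lemma rooted_tree_graft: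
  assumes t1: "rooted_tree t1" and t2: "rooted_tree t2"
    and disj: "verts t1 \<inter> verts t2 = {}" and v: "v \<in> verts t2"
  shows "rooted_tree (graft t1 v t2)"
proof -
  note r1 = t1[unfolded rooted_tree_def] and r2 = t2[unfolded rooted_tree_def]
  let ?E = "edges (graft t1 v t2)"
  have sub: "(edges t1)\<^sup>* \<subseteq> ?E\<^sup>*" "(edges t2)\<^sup>* \<subseteq> ?E\<^sup>*"
    by (auto simp: graft_def intro!: rtrancl_mono)
  have reach2: "(root_vertex t2, w) \<in> ?E\<^sup>*" if "w \<in> verts t2" for w
    using that r2 sub by blast
  have "(root_vertex t2, root_vertex t1) \<in> ?E\<^sup>*"
    using reach2[OF v] by (rule rtrancl_into_rtrancl) (simp add: graft_def)
  then have reach1: "(root_vertex t2, w) \<in> ?E\<^sup>*" if "w \<in> verts t1" for w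
    using that r1 sub by (meson rtrancl_trans subsetD)
  have E: "?E = edges t1 \<union> edges t2 \<union> {(v, root_vertex t1)}" by (simp add: graft_def)
  have E1: "u \<in> verts t1" "w \<in> verts t1" "w \<noteq> root_vertex t1" if "(u, w) \<in> edges t1" for u w
    using that r1 by auto
  have E2: "u \<in> verts t2" "w \<in> verts t2" "w \<noteq> root_vertex t2" if "(u, w) \<in> edges t2" for u w
    using that r2 by auto
  have roots: "root_vertex t1 \<in> verts t1" "root_vertex t2 \<in> verts t2"
    "root_vertex t1 \<notin> verts t2" "root_vertex t2 \<notin> verts t1"
    using r1 r2 disj by auto
  have "\<forall>u. (u, root_vertex t2) \<notin> ?E"
    using E1(2) E2(3) roots unfolding E by auto
  moreover have "\<forall>u u' w. (u, w) \<in> ?E \<longrightarrow> (u', w) \<in> ?E \<longrightarrow> u = u'"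
  proof (intro allI impI)
    fix u u' w assume a: "(u, w) \<in> ?E" "(u', w) \<in> ?E"
    have u1: "x = y" if "(x, w) \<in> edges t1" "(y, w) \<in> edges t1" for x y
      using that r1 by blast
    have u2: "x = y" if "(x, w) \<in> edges t2" "(y, w) \<in> edges t2" for x y
      using that r2 by blast
    consider "w = root_vertex t1" | "w \<in> verts t1" "w \<noteq> root_vertex t1" | "w \<notin> verts t1" by blast
    then show "u = u'"
    proof cases
      case 1
      then show ?thesis using a E1(3) E2(2) roots unfolding E by auto
    next
      case 2
      then have "w \<notin> verts t2" using disj by auto
      then show ?thesis using 2 a E2(2) u1 unfolding E by auto
    next
      case 3
      then show ?thesis using a E1(2) roots u2 unfolding E by auto
    qed
  qed
  moreover have "?E \<subseteq> verts (graft t1 v t2) \<times> verts (graft t1 v t2)"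
    using r1 r2 v by (auto simp: graft_def)
  moreover have "finite (verts (graft t1 v t2))"
    "root_vertex (graft t1 v t2) = root_vertex t2" "verts (graft t1 v t2) = verts t1 \<union> verts t2"
    using r1 r2 by (simp_all add: graft_def)
  ultimately show ?thesis
    unfolding rooted_tree_def using roots reach1 reach2 by (metis UnE UnI2)
qed

lemma is_couple_graft:
  assumes c1: "is_couple (t1, s1)" and c2: "is_couple (t2, s2)"
    and disj: "verts t1 \<inter> verts t2 = {}" and v: "v \<in> verts t2 - verts s2"
  shows "is_couple (graft t1 v t2, forest_union s1 s2)"
proof -
  obtain W1 where W1: "up_closed t1 W1" "s1 = induced t1 W1" and t1: "rooted_tree t1"
    using c1 by (auto simp: is_couple_iff)
  obtain W2 where W2: "up_closed t2 W2" "s2 = induced t2 W2" and t2: "rooted_tree t2"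
    using c2 by (auto simp: is_couple_iff)
  note E = is_couple_subforest(3)[OF c1] is_couple_subforest(3)[OF c2]
  have v': "v \<notin> W2" "v \<notin> W1" "v \<in> verts t2"
    using v W1 W2 disj by (auto simp: induced_def up_closed_def)
  have W: "W1 \<subseteq> verts t1" "W2 \<subseteq> verts t2" "edges t1 `` W1 \<subseteq> W1" "edges t2 `` W2 \<subseteq> W2"
    using W1 W2 by (auto simp: up_closed_def)
  have "edges t1 `` W2 = {}" "edges t2 `` W1 = {}"
    using E W disj by blast+
  then have "up_closed (graft t1 v t2) (W1 \<union> W2)"
    using W v' by (auto simp: up_closed_def graft_def)
  moreover have "edges t1 \<inter> (W1 \<times> W1) \<union> edges t2 \<inter> (W2 \<times> W2) =
      (edges t1 \<union> edges t2 \<union> {(v, root_vertex t1)}) \<inter> ((W1 \<union> W2) \<times> (W1 \<union> W2))"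
    using E W disj v' by blast
  then have "forest_union s1 s2 = induced (graft t1 v t2) (W1 \<union> W2)"
    using W1 W2 by (simp add: forest_union_def induced_def graft_def)
  ultimately show ?thesis using rooted_tree_graft[OF t1 t2 disj v'(3)]
    by (auto simp: is_couple_iff)
qed

lemma is_couple_graft_couple:
  assumes c1: "is_couple (t1, s1)" and c2: "is_couple (t2, s2)"
    and v: "v \<in> verts t2 - verts s2"
  shows "is_couple (graft_couple (t1, s1) v (t2, s2))"
  unfolding graft_couple_def prod.case
proof (rule is_couple_graft)
  show "is_couple (relabel_tree left_copy t1, relabel_forest left_copy s1)"
    by (rule is_couple_relabel[OF c1 inj_on_subset[OF inj_left_copy]]) simp
  show "is_couple (relabel_tree right_copy t2, relabel_forest right_copy s2)"
    by (rule is_couple_relabel[OF c2 inj_on_subset[OF inj_right_copy]]) simp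
qed (use v in \<open>auto simp: relabel_tree_def relabel_forest_def left_copy_neq_right_copy
       dest: injD[OF inj_right_copy]\<close>)

lemma couple_iso_graft_couple:
  assumes c1: "is_couple (t1, s1)" and c2: "is_couple (t2, s2)"
    and v: "v \<in> verts t2 - verts s2"
    and f: "inj_on f (verts t1)" and g: "inj_on g (verts t2)"
  shows "couple_iso (graft_couple (t1, s1) v (t2, s2))
    (graft_couple (relabel_tree f t1, relabel_forest f s1) (g v)
      (relabel_tree g t2, relabel_forest g s2))"
proof -
  define h where "h n = (if even n then left_copy (f (n div 2)) else right_copy (g (n div 2)))"
    for n
  have h [simp]: "h (left_copy x) = left_copy (f x)" "h (right_copy x) = right_copy (g x)" for x
    by (auto simp: h_def left_copy_def right_copy_def)
  have comp [simp]: "h \<circ> left_copy = left_copy \<circ> f" "h \<circ> right_copy = right_copy \<circ> g"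
    by auto
  let ?c = "graft_couple (t1, s1) v (t2, s2)"
  let ?c' = "graft_couple (relabel_tree f t1, relabel_forest f s1) (g v)
      (relabel_tree g t2, relabel_forest g s2)"
  have "g v \<notin> g ` verts s2"
    using v g is_couple_subforest(1)[OF c2] by (auto dest: inj_onD)
  then have c': "is_couple ?c'"
    using v by (intro is_couple_graft_couple is_couple_relabel c1 c2 f g)
      (auto simp: relabel_tree_def relabel_forest_def)
  have "inj_on h (verts (fst ?c))"
  proof (rule inj_onI)
    fix x y assume "x \<in> verts (fst ?c)" "y \<in> verts (fst ?c)" "h x = h y"
    then show "x = y"
      using left_copy_neq_right_copy left_copy_neq_right_copy[symmetric]
      by (auto simp: graft_couple_def graft_def relabel_tree_def
          dest!: injD[OF inj_left_copy] injD[OF inj_right_copy] inj_onD[OF f] inj_onD[OF g])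
  qed
  moreover have "fst ?c' = relabel_tree h (fst ?c)"
    by (simp add: graft_couple_def graft_def relabel_tree_def image_Un image_comp prod.map_comp)
  moreover have "snd ?c' = relabel_forest h (snd ?c)"
    by (simp add: graft_couple_def forest_union_def relabel_forest_def image_Un image_comp
        prod.map_comp)
  ultimately show ?thesis
    using c' is_couple_graft_couple[OF c1 c2 v] unfolding couple_iso_def
    by (cases ?c; cases ?c') auto
qed

text \<open>
  The vector space is \<open>couple \<Rightarrow>\<^sub>0 'k\<close>, the finitely supported functions, with basis
  \<open>Poly_Mapping.single p 1\<close>.
\<close>

definition scale :: "'k::field \<Rightarrow> (couple \<Rightarrow>\<^sub>0 'k) \<Rightarrow> (couple \<Rightarrow>\<^sub>0 'k)" where
  "scale a x = Poly_Mapping.map (\<lambda>b. a * b) x"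

lift_definition graft_sum :: "couple \<Rightarrow> couple \<Rightarrow> (couple \<Rightarrow>\<^sub>0 'k::field)" is
  "\<lambda>(t1, s1) (t2, s2).
     \<Sum>v\<in>verts t2 - verts s2.
       Poly_Mapping.single (abs_couple (graft_couple (t1, s1) v (t2, s2))) 1"
proof -
  fix c1 c1' c2 c2' :: "tree \<times> forest"
  assume iso: "couple_iso c1 c1'" "couple_iso c2 c2'"
  obtain t1 s1 t1' s1' t2 s2 t2' s2' where c: "c1 = (t1, s1)" "c1' = (t1', s1')"
    "c2 = (t2, s2)" "c2' = (t2', s2')"
    by (cases c1; cases c1'; cases c2; cases c2') auto
  from iso(1) c obtain f where f: "is_couple (t1, s1)" "inj_on f (verts t1)"
    "t1' = relabel_tree f t1" "s1' = relabel_forest f s1" by (auto simp: couple_iso_def)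
  from iso(2) c obtain g where g: "is_couple (t2, s2)" "inj_on g (verts t2)"
    "t2' = relabel_tree g t2" "s2' = relabel_forest g s2" by (auto simp: couple_iso_def)
  have "verts t2' - verts s2' = g ` (verts t2 - verts s2)"
    using inj_on_image_set_diff[OF g(2) _ is_couple_subforest(1)[OF g(1)]] g
    by (simp add: relabel_tree_def relabel_forest_def)
  then have bij: "bij_betw g (verts t2 - verts s2) (verts t2' - verts s2')"
    using g by (auto simp: bij_betw_def intro: inj_on_subset)
  have "(\<Sum>v\<in>verts t2 - verts s2.
           Poly_Mapping.single (abs_couple (graft_couple (t1, s1) v (t2, s2))) (1::'k)) =
        (\<Sum>v\<in>verts t2 - verts s2.
           Poly_Mapping.single (abs_couple (graft_couple (t1', s1') (g v) (t2', s2'))) 1)"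
  proof (rule sum.cong)
    fix v assume "v \<in> verts t2 - verts s2"
    then have "couple_iso (graft_couple (t1, s1) v (t2, s2)) (graft_couple (t1', s1') (g v) (t2', s2'))"
      using couple_iso_graft_couple f g by simp
    then have "abs_couple (graft_couple (t1, s1) v (t2, s2)) =
        abs_couple (graft_couple (t1', s1') (g v) (t2', s2'))"
      by (rule Quotient_rel_abs[OF Quotient_couple])
    then show "Poly_Mapping.single (abs_couple (graft_couple (t1, s1) v (t2, s2))) (1::'k) =
        Poly_Mapping.single (abs_couple (graft_couple (t1', s1') (g v) (t2', s2'))) 1"
      by simp
  qed simp
  also have "\<dots> = (\<Sum>v\<in>verts t2' - verts s2'.
           Poly_Mapping.single (abs_couple (graft_couple (t1', s1') v (t2', s2'))) 1)"
    by (rule sum.reindex_bij_betw[OF bij])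
  finally show "?thesis c1 c1' c2 c2'" using c by simp
qed

definition leadsto :: "(couple \<Rightarrow>\<^sub>0 'k::field) \<Rightarrow> (couple \<Rightarrow>\<^sub>0 'k) \<Rightarrow> (couple \<Rightarrow>\<^sub>0 'k)"
    (infixl \<open>\<leadsto>\<close> 70) where
  "x \<leadsto> y =
     (\<Sum>p\<in>Poly_Mapping.keys x. \<Sum>q\<in>Poly_Mapping.keys y.
        scale (Poly_Mapping.lookup x p * Poly_Mapping.lookup y q) (graft_sum p q))"

locale left_pre_lie_algebra = vector_space scl
  for scl :: "'k::field \<Rightarrow> 'a::ab_group_add \<Rightarrow> 'a" +
  fixes prd :: "'a \<Rightarrow> 'a \<Rightarrow> 'a"
  assumes linear_left: "Vector_Spaces.linear scl scl (\<lambda>x. prd x y)"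
    and linear_right: "Vector_Spaces.linear scl scl (\<lambda>y. prd x y)"
    and left_pre_lie:
      "prd (prd x y) z - prd x (prd y z) = prd (prd y x) z - prd y (prd x z)"

end

theory Submission
  imports Defs
begin

text \<open>
  On couples with pairwise disjoint vertex sets, splitting the grafting vertices of \<open>t\<^sub>1\<close> on
  \<open>t\<^sub>2 \<rightarrow>\<^sub>w t\<^sub>3\<close> into those of \<open>t\<^sub>2 - s\<^sub>2\<close> and those of \<open>t\<^sub>3 - s\<^sub>3\<close> shows that
  \<open>x \<leadsto> (y \<leadsto> z) - (x \<leadsto> y) \<leadsto> z\<close> is the sum over pairs of vertices \<open>v, w\<close> of \<open>t\<^sub>3 - s\<^sub>3\<close> of the
  trees obtained by grafting \<open>t\<^sub>1\<close> on \<open>v\<close> and \<open>t\<^sub>2\<close> on \<open>w\<close>, which is symmetric in \<open>x\<close> and \<open>y\<close>.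
\<close>

section \<open>Representatives of couples\<close>

lemma abs_couple_relabel:
  assumes "is_couple (t, s)" and "inj_on f (verts t)"
  shows "abs_couple (relabel_tree f t, relabel_forest f s) = abs_couple (t, s)"
proof -
  have "couple_iso (t, s) (relabel_tree f t, relabel_forest f s)"
    using assms is_couple_relabel by (auto simp: couple_iso_def)
  then show ?thesis
    using Quotient_rel_abs[OF Quotient_couple] by metis
qed

text \<open>Injections with disjoint ranges thus give representatives with disjoint vertex sets, on
  which grafting needs no further renaming.\<close>

lemma couple_representative_in_range:
  fixes f :: "nat \<Rightarrow> nat"
  assumes "inj f"
  obtains t s where "is_couple (t, s)" "verts t \<subseteq> range f" "p = abs_couple (t, s)"
proof -
  obtain t s where ts: "rep_couple p = (t, s)" by (cases "rep_couple p")
  \<comment> \<open>In a partial quotient, the chosen representative is related to itself; this is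
    where \<open>is_couple\<close> comes from.\<close>
  have "couple_iso (t, s) (t, s)"
    using Quotient_rep_reflp[OF Quotient_couple, of p] ts by simp
  then have c: "is_couple (t, s)" by (simp add: couple_iso_def)
  have inj: "inj_on f (verts t)" using assms by (rule inj_on_subset) simp
  have "p = abs_couple (t, s)"
    using Quotient_abs_rep[OF Quotient_couple, of p] ts by simp
  then show thesis
    using that[OF is_couple_relabel[OF c inj]] abs_couple_relabel[OF c inj]
    by (auto simp: relabel_tree_def)
qed

text \<open>The copies made by \<open>graft_couple\<close> only serve to separate the vertex sets.
  If these are disjoint already, the two renamings glue to one injection on the grafted tree, hence
  to an isomorphism of couples.\<close>

lemma abs_graft_couple_disjoint:
  assumes c1: "is_couple (t1, s1)" and c2: "is_couple (t2, s2)"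
    and disj: "verts t1 \<inter> verts t2 = {}" and v: "v \<in> verts t2 - verts s2"
  shows "abs_couple (graft_couple (t1, s1) v (t2, s2)) =
    abs_couple (graft t1 v t2, forest_union s1 s2)"
proof -
  let ?h = "\<lambda>n. if n \<in> verts t1 then left_copy n else right_copy n"
  note sub = is_couple_subforest[OF c1] is_couple_subforest[OF c2]
  have h1: "?h x = left_copy x" if "x \<in> verts t1" for x using that by simp
  have h2: "?h x = right_copy x" if "x \<in> verts t2" for x using that disj by auto
  have V1: "?h ` A = left_copy ` A" if "A \<subseteq> verts t1" for A
    using that by (intro image_cong refl h1) blast
  have V2: "?h ` A = right_copy ` A" if "A \<subseteq> verts t2" for A
    using that by (intro image_cong refl h2) blast
  have E1: "map_prod ?h ?h ` A = map_prod left_copy left_copy ` A"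
    if A: "A \<subseteq> verts t1 \<times> verts t1" for A
  proof (rule image_cong[OF refl])
    fix e assume "e \<in> A"
    then show "map_prod ?h ?h e = map_prod left_copy left_copy e" using A h1 by (cases e) auto
  qed
  have E2: "map_prod ?h ?h ` A = map_prod right_copy right_copy ` A"
    if A: "A \<subseteq> verts t2 \<times> verts t2" for A
  proof (rule image_cong[OF refl])
    fix e assume "e \<in> A"
    then have "fst e \<in> verts t2" "snd e \<in> verts t2" using A by auto
    then show "map_prod ?h ?h e = map_prod right_copy right_copy e"
      using h2 by (cases e) simp
  qed
  have es: "edges s1 \<subseteq> verts t1 \<times> verts t1" "edges s2 \<subseteq> verts t2 \<times> verts t2"
    using sub by blast+
  have inj: "inj_on ?h (verts (graft t1 v t2))"
    using left_copy_neq_right_copy left_copy_neq_right_copy[symmetric]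
    by (auto simp: inj_on_def graft_def dest: injD[OF inj_left_copy] injD[OF inj_right_copy])
  have hv: "?h v = right_copy v" "?h (root_vertex t1) = left_copy (root_vertex t1)"
    "?h (root_vertex t2) = right_copy (root_vertex t2)"
    using h1 h2 v sub by blast+
  have "relabel_tree ?h (graft t1 v t2) =
      graft (relabel_tree left_copy t1) (right_copy v) (relabel_tree right_copy t2)"
    unfolding relabel_tree_def graft_def
    using V1[OF order_refl] V2[OF order_refl] E1[OF sub(3)] E2[OF sub(8)] hv
    by (simp only: forest.simps tree.simps image_Un image_insert image_empty map_prod_simp)
  moreover have "relabel_forest ?h (forest_union s1 s2) =
      forest_union (relabel_forest left_copy s1) (relabel_forest right_copy s2)"
    unfolding relabel_forest_def forest_union_def
    using V1[OF sub(1)] V2[OF sub(6)] E1[OF es(1)] E2[OF es(2)]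
    by (simp only: forest.simps image_Un)
  ultimately show ?thesis
    using abs_couple_relabel[OF is_couple_graft[OF c1 c2 disj v] inj]
    by (simp add: graft_couple_def)
qed

lemma finite_verts_couple: "is_couple (t, s) \<Longrightarrow> finite (verts t)"
  by (simp add: is_couple_def rooted_tree_def)

lemma graft_sum_disjoint:
  assumes "is_couple (t1, s1)" "is_couple (t2, s2)" "verts t1 \<inter> verts t2 = {}"
  shows "graft_sum (abs_couple (t1, s1)) (abs_couple (t2, s2)) =
    (\<Sum>v\<in>verts t2 - verts s2.
       Poly_Mapping.single (abs_couple (graft t1 v t2, forest_union s1 s2)) 1)"
  using assms
  by (auto simp: graft_sum.abs_eq couple_iso_refl abs_graft_couple_disjoint intro!: sum.cong)

section \<open>Bilinearity\<close>

lemma lookup_scale [simp]: "Poly_Mapping.lookup (scale a x) p = a * Poly_Mapping.lookup x p"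
  by (simp add: scale_def Poly_Mapping.map.rep_eq when_def)

interpretation couples: vector_space "scale :: 'k::field \<Rightarrow> (couple \<Rightarrow>\<^sub>0 'k) \<Rightarrow> (couple \<Rightarrow>\<^sub>0 'k)"
  by standard (auto intro!: poly_mapping_eqI simp: lookup_add algebra_simps)

text \<open>Outside the keys the coefficient is 0 and the term vanishes. Enlarging the index sets
  lets the products of \<open>x\<close>, \<open>x'\<close> and \<open>x + x'\<close> be compared
  over common sets, since the keys of a sum may shrink by cancellation.\<close>

lemma leadsto_eq_sum_superset:
  assumes "finite A" "Poly_Mapping.keys x \<subseteq> A" "finite B" "Poly_Mapping.keys y \<subseteq> B"
  shows "x \<leadsto> y = (\<Sum>p\<in>A. \<Sum>q\<in>B.
    scale (Poly_Mapping.lookup x p * Poly_Mapping.lookup y q) (graft_sum p q))"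
proof -
  have "x \<leadsto> y = (\<Sum>p\<in>Poly_Mapping.keys x. \<Sum>q\<in>B.
      scale (Poly_Mapping.lookup x p * Poly_Mapping.lookup y q) (graft_sum p q))"
    unfolding leadsto_def using assms
    by (intro sum.cong refl sum.mono_neutral_left) (auto simp: in_keys_iff)
  also have "\<dots> = (\<Sum>p\<in>A. \<Sum>q\<in>B.
      scale (Poly_Mapping.lookup x p * Poly_Mapping.lookup y q) (graft_sum p q))"
    using assms by (intro sum.mono_neutral_left) (auto simp: in_keys_iff)
  finally show ?thesis .
qed

lemma leadsto_add_left: "(x + x') \<leadsto> y = x \<leadsto> y + x' \<leadsto> y"
proof -
  let ?A = "Poly_Mapping.keys x \<union> Poly_Mapping.keys x'"
  note expand = leadsto_eq_sum_superset[of ?A _ "Poly_Mapping.keys y" y]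
  show ?thesis
    using Poly_Mapping.keys_add[of x x']
    by (simp add: expand lookup_add distrib_right couples.scale_left_distrib sum.distrib)
qed

lemma leadsto_add_right: "x \<leadsto> (y + y') = x \<leadsto> y + x \<leadsto> y'"
proof -
  let ?B = "Poly_Mapping.keys y \<union> Poly_Mapping.keys y'"
  note expand = leadsto_eq_sum_superset[of "Poly_Mapping.keys x" x ?B]
  show ?thesis
    using Poly_Mapping.keys_add[of y y']
    by (simp add: expand lookup_add distrib_left couples.scale_left_distrib sum.distrib)
qed

lemma keys_scale_subset: "Poly_Mapping.keys (scale a x) \<subseteq> Poly_Mapping.keys x"
  by (auto simp: in_keys_iff)

lemma leadsto_scale_left: "scale a x \<leadsto> y = scale a (x \<leadsto> y)"
  using leadsto_eq_sum_superset[of "Poly_Mapping.keys x" "scale a x" "Poly_Mapping.keys y" y]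
    keys_scale_subset[of a x]
  by (simp add: leadsto_def couples.scale_sum_right mult.assoc)

lemma leadsto_scale_right: "x \<leadsto> scale a y = scale a (x \<leadsto> y)"
  using leadsto_eq_sum_superset[of "Poly_Mapping.keys x" x "Poly_Mapping.keys y" "scale a y"]
    keys_scale_subset[of a y]
  by (simp add: leadsto_def couples.scale_sum_right mult.left_commute)

lemma linear_leadsto_left: "Vector_Spaces.linear scale scale (\<lambda>x. x \<leadsto> y)"
  by (simp add: Vector_Spaces.linear_iff couples.vector_space_axioms leadsto_add_left leadsto_scale_left)

lemma linear_leadsto_right: "Vector_Spaces.linear scale scale (\<lambda>y. x \<leadsto> y)"
  by (simp add: Vector_Spaces.linear_iff couples.vector_space_axioms leadsto_add_right leadsto_scale_right)

lemmas leadsto_sum_left = module_hom.sum[OF module_hom_linearI[OF linear_leadsto_left]]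
lemmas leadsto_sum_right = module_hom.sum[OF module_hom_linearI[OF linear_leadsto_right]]

lemma couple_combination_induct [case_names add scale basis]:
  fixes x :: "couple \<Rightarrow>\<^sub>0 'k::field"
  assumes add: "\<And>x y. P x \<Longrightarrow> P y \<Longrightarrow> P (x + y)" and scale: "\<And>a x. P x \<Longrightarrow> P (scale a x)"
    and basis: "\<And>p. P (Poly_Mapping.single p 1)"
  shows "P x"
proof (induction x rule: update_induct)
  case const
  \<comment> \<open>The zero vector is 0 times a basis vector.\<close>
  then show ?case using scale[OF basis, of 0] by simp
next
  case (update x p a)
  \<comment> \<open>As \<open>p\<close> is not a key of \<open>x\<close>, its old coefficient is 0,
    so overwriting it amounts to adding \<open>a\<close>.\<close>
  have "Poly_Mapping.update p a x = x + scale a (Poly_Mapping.single p 1)"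
    using update(1)
    by (auto intro!: poly_mapping_eqI
        simp: lookup_update lookup_add lookup_single in_keys_iff when_def)
  then show ?case using add[OF update(3) scale[OF basis]] by simp
qed

section \<open>The pre-Lie identity\<close>

lemma leadsto_single_disjoint:
  assumes "is_couple (t1, s1)" "is_couple (t2, s2)" "verts t1 \<inter> verts t2 = {}"
  shows "Poly_Mapping.single (abs_couple (t1, s1)) (1::'k::field) \<leadsto>
      Poly_Mapping.single (abs_couple (t2, s2)) 1 =
    (\<Sum>v\<in>verts t2 - verts s2.
       Poly_Mapping.single (abs_couple (graft t1 v t2, forest_union s1 s2)) 1)"
  by (simp add: leadsto_def graft_sum_disjoint[OF assms])

text \<open>Grafting unites vertices and edges and adds one edge, and the root of
  \<open>graft t1 v t2\<close> is that of \<open>t2\<close>. Both sides are therefore the same tree,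
  not merely isomorphic ones.\<close>

lemma graft_graft: "graft (graft t1 v t2) w t3 = graft t1 v (graft t2 w t3)"
  by (auto simp: graft_def)

text \<open>Either order adds the same two edges and keeps the root of \<open>t3\<close>. This is
  the source of the symmetry in the first two arguments.\<close>

lemma graft_commute: "graft t1 v (graft t2 w t3) = graft t2 w (graft t1 v t3)"
  by (auto simp: graft_def)

lemma forest_union_assoc: "forest_union (forest_union s1 s2) s3 = forest_union s1 (forest_union s2 s3)"
  by (simp add: forest_union_def Un_assoc)

lemma forest_union_left_commute:
  "forest_union s1 (forest_union s2 s3) = forest_union s2 (forest_union s1 s3)"
  by (simp add: forest_union_def Un_left_commute)

lemma associator_single_disjoint:
  fixes x y z :: "couple \<Rightarrow>\<^sub>0 'k::field"
  assumes c1: "is_couple (t1, s1)" and c2: "is_couple (t2, s2)" and c3: "is_couple (t3, s3)"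
    and d12: "verts t1 \<inter> verts t2 = {}" and d13: "verts t1 \<inter> verts t3 = {}"
    and d23: "verts t2 \<inter> verts t3 = {}"
    and xyz: "x = Poly_Mapping.single (abs_couple (t1, s1)) 1"
      "y = Poly_Mapping.single (abs_couple (t2, s2)) 1"
      "z = Poly_Mapping.single (abs_couple (t3, s3)) 1"
  shows "(x \<leadsto> y) \<leadsto> z - x \<leadsto> (y \<leadsto> z) =
    - (\<Sum>v\<in>verts t3 - verts s3. \<Sum>w\<in>verts t3 - verts s3. Poly_Mapping.single
         (abs_couple (graft t1 v (graft t2 w t3), forest_union s1 (forest_union s2 s3))) 1)"
proof -
  let ?V2 = "verts t2 - verts s2" and ?V3 = "verts t3 - verts s3"
  let ?b = "\<lambda>v w. Poly_Mapping.single
    (abs_couple (graft t1 v (graft t2 w t3), forest_union s1 (forest_union s2 s3))) (1::'k)"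
  note sub = is_couple_subforest(1)[OF c1] is_couple_subforest(1)[OF c2] is_couple_subforest(1)[OF c3]
  have left: "Poly_Mapping.single (abs_couple (graft t1 v t2, forest_union s1 s2)) 1 \<leadsto> z =
      (\<Sum>w\<in>?V3. ?b v w)" if "v \<in> ?V2" for v
  proof -
    have d: "verts (graft t1 v t2) \<inter> verts t3 = {}"
      using d13 d23 by (auto simp: graft_def)
    show ?thesis
      unfolding xyz leadsto_single_disjoint[OF is_couple_graft[OF c1 c2 d12 that] c3 d]
        graft_graft forest_union_assoc ..
  qed
  have right: "x \<leadsto> Poly_Mapping.single (abs_couple (graft t2 w t3, forest_union s2 s3)) 1 =
      (\<Sum>v\<in>?V2. ?b v w) + (\<Sum>v\<in>?V3. ?b v w)" if "w \<in> ?V3" for w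
  proof -
    \<comment> \<open>Disjointness ensures that removing \<open>s2\<close> deletes no vertex of
      \<open>t3\<close>, and removing \<open>s3\<close> none of \<open>t2\<close>.\<close>
    have V: "verts (graft t2 w t3) - verts (forest_union s2 s3) = ?V2 \<union> ?V3"
      using sub d23 by (auto simp: graft_def forest_union_def)
    have d: "verts t1 \<inter> verts (graft t2 w t3) = {}"
      using d12 d13 by (auto simp: graft_def)
    show ?thesis
      unfolding xyz leadsto_single_disjoint[OF c1 is_couple_graft[OF c2 c3 d23 that] d] V
      using d23 finite_verts_couple[OF c2] finite_verts_couple[OF c3]
      by (intro sum.union_disjoint) auto
  qed
  have "(x \<leadsto> y) \<leadsto> z = (\<Sum>v\<in>?V2. \<Sum>w\<in>?V3. ?b v w)"
    using left by (simp add: xyz(1,2) leadsto_single_disjoint[OF c1 c2 d12] leadsto_sum_left)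
  also have "\<dots> = (\<Sum>w\<in>?V3. \<Sum>v\<in>?V2. ?b v w)"
    by (rule sum.swap)
  finally have "(x \<leadsto> y) \<leadsto> z = (\<Sum>w\<in>?V3. \<Sum>v\<in>?V2. ?b v w)" .
  \<comment> \<open>The first double sum equals \<open>(x \<leadsto> y) \<leadsto> z\<close> and
    cancels in the associator.\<close>
  moreover have "x \<leadsto> (y \<leadsto> z) =
      (\<Sum>w\<in>?V3. \<Sum>v\<in>?V2. ?b v w) + (\<Sum>w\<in>?V3. \<Sum>v\<in>?V3. ?b v w)"
    using right
    by (simp add: xyz(2,3) leadsto_single_disjoint[OF c2 c3 d23] leadsto_sum_right sum.distrib)
  moreover have "(\<Sum>w\<in>?V3. \<Sum>v\<in>?V3. ?b v w) = (\<Sum>v\<in>?V3. \<Sum>w\<in>?V3. ?b v w)"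
    by (rule sum.swap)
  ultimately show ?thesis by simp
qed

lemma left_pre_lie_single:
  fixes p q r :: couple
  defines "x \<equiv> Poly_Mapping.single p (1::'k::field)" and "y \<equiv> Poly_Mapping.single q 1"
    and "z \<equiv> Poly_Mapping.single r 1"
  shows "(x \<leadsto> y) \<leadsto> z - x \<leadsto> (y \<leadsto> z) = (y \<leadsto> x) \<leadsto> z - y \<leadsto> (x \<leadsto> z)"
proof -
  \<comment> \<open>The three residue classes modulo 3 keep the vertex sets of the representatives
    apart.\<close>
  let ?f = "\<lambda>i n. 3 * n + i :: nat"
  have inj: "inj (?f i)" for i by (simp add: inj_def)
  obtain t1 s1 where 1: "is_couple (t1, s1)" "verts t1 \<subseteq> range (?f 0)" "p = abs_couple (t1, s1)"
    using couple_representative_in_range[OF inj] .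
  obtain t2 s2 where 2: "is_couple (t2, s2)" "verts t2 \<subseteq> range (?f 1)" "q = abs_couple (t2, s2)"
    using couple_representative_in_range[OF inj] .
  obtain t3 s3 where 3: "is_couple (t3, s3)" "verts t3 \<subseteq> range (?f 2)" "r = abs_couple (t3, s3)"
    using couple_representative_in_range[OF inj] .
  have "?f 0 a \<noteq> ?f 1 b" "?f 0 a \<noteq> ?f 2 b" "?f 1 a \<noteq> ?f 2 b" for a b
    by presburger+
  then have disj: "verts t1 \<inter> verts t2 = {}" "verts t1 \<inter> verts t3 = {}" "verts t2 \<inter> verts t3 = {}"
    using 1(2) 2(2) 3(2) by blast+
  then have disj': "verts t2 \<inter> verts t1 = {}" by blast
  have x: "x = Poly_Mapping.single (abs_couple (t1, s1)) 1"
    and y: "y = Poly_Mapping.single (abs_couple (t2, s2)) 1"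
    and z: "z = Poly_Mapping.single (abs_couple (t3, s3)) 1"
    using 1(3) 2(3) 3(3) by (simp_all add: x_def y_def z_def)
  show ?thesis
    unfolding associator_single_disjoint[OF 1(1) 2(1) 3(1) disj x y z]
      associator_single_disjoint[OF 2(1) 1(1) 3(1) disj' disj(3,2) y x z]
      \<comment> \<open>Fixing the tree and forest arguments orients the rewriting:
        \<open>t2\<close> and \<open>s2\<close> move outside on the left-hand side, and the
        right-hand side already has this form. Only the order of the two summations then
        differs.\<close>
      graft_commute[of t1 _ t2] forest_union_left_commute[of s1 s2]
    by (rule arg_cong[of _ _ uminus]) (rule sum.swap)
qed

lemma left_pre_lie_leadsto:
  "(x \<leadsto> y) \<leadsto> z - x \<leadsto> (y \<leadsto> z) = (y \<leadsto> x) \<leadsto> z - y \<leadsto> (x \<leadsto> z)"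
proof -
  note bilinear = leadsto_add_left leadsto_add_right leadsto_scale_left leadsto_scale_right
  \<comment> \<open>These rules regroup a difference of sums into a sum of associators and pull
    scalars out of an associator, so that the induction hypotheses apply in each argument.\<close>
  note combine = bilinear add_diff_add couples.scale_right_diff_distrib[symmetric]
  show ?thesis
  proof (induction x rule: couple_combination_induct)
    case (basis p)
    show ?case
    proof (induction y rule: couple_combination_induct)
      case (basis q)
      show ?case
        by (induction z rule: couple_combination_induct)
          (simp_all add: combine left_pre_lie_single)
    qed (simp_all add: combine)
  qed (simp_all add: combine)
qed

theorem theorem5:
  shows "left_pre_lie_algebra (scale :: 'k::field \<Rightarrow> (couple \<Rightarrow>\<^sub>0 'k) \<Rightarrow> (couple \<Rightarrow>\<^sub>0 'k)) (\<leadsto>)"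
  by unfold_locales
    (simp_all only: left_pre_lie_leadsto leadsto_add_left leadsto_add_right
      leadsto_scale_left leadsto_scale_right)

end
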